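(* In generating a feasible rack sequence for a single picker we can initially neglect all orders which comprise a single unit of one product (the orders $o\in O_1^*$). This is because a feasible rack sequence for the remaining orders (the orders $o\in O^*\setminus O_1^*$) can be easily modified to incorporate the neglected orders, provided that: (a) the set of racks allocated to the picker collectively contain sufficient of each product to satisfy all of the orders allocated to the picker, i.e. $\sum_{o\in O^*}q_{io}\le\sum_{r\in R^*}s_{ir}$ for all $i\in N^*$; and (b) we have a single bin permanently and solely dedicated for use by orders opened and closed by the same rack, so that the formulation being considered is PRSF1, as defined in the context.
   Context: Single-picker rack sequencing. A single picker has been allocated a finite set of orders $O^*$ and a finite set of racks $R^*$, with $K=|R^*|$. The racks must be put in a sequence for presentation to the picker. Order $o$ requires $q_{io}\in\mathbb{Z}_{\ge 0}$ units of product $i$; rack $r$ contains $s_{ir}\in\mathbb{Z}_{\ge 0}$ units of product $i$. $N^*$ is the set of products $i$ with $\sum_{o\in O^*}q_{io}\ge 1$. The picker has $B$ bin positions; an order occupies a bin from when its first item is picked (it is opened) until all its items have been picked (it is closed). $O_1^*=\{o\in O^*:\sum_{i\in N^*}q_{io}=1\}$ is the set of orders comprising a single unit of one product, and for $o\in O_1^*$, $\tau(o)$ is the unique product required by $o$. Variables, for $k=1,\dots,K$: $z_{kr}\in\{0,1\}$, equal to 1 if rack $r\in R^*$ is the $k$'th rack presented to the picker; $\alpha_{ok}\in\{0,1\}$, equal to 1 if order $o$ is open at some point while the $k$'th rack is presented; $\beta_{ok}\in\{0,1\}$, equal to 1 if order $o$ is closed while the $k$'th rack is presented; $\gamma_{iok}\in\mathbb{Z}_{\ge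 0}$, the number of units of product $i\in N^*$ for order $o$ taken from the $k$'th presented rack. Formulation PRSF1 for a set of orders $O'$ (here $O'=O^*$, or $O'=O^*\setminus O_1^*$ when the orders in $O_1^*$ are neglected; write $O_1'=O'\cap O_1^*$) consists of the constraints: (1) $\sum_{k=1}^K z_{kr}=1$ for all $r\in R^*$; (2) $\sum_{r\in R^*}z_{kr}=1$ for all $k\in\{1,\dots,K\}$; (3) $\sum_{o\in O'}\gamma_{iok}\le\sum_{r\in R^*}s_{ir}z_{kr}$ for all $i\in N^*$, $k\in\{1,\dots,K\}$; (4) $\sum_{k=1}^K\gamma_{iok}=q_{io}$ for all $i\in N^*$, $o\in O'$; (5) $\gamma_{iok}\le q_{io}\alpha_{ok}$ for all $i\in N^*$, $o\in O'$, $k\in\{1,\dots,K\}$; (6) $\sum_{o\in O'}(\alpha_{ok}-\beta_{ok})\le B-1$ for all $k\in\{1,\dots,K\}$ (one of the $B$ bins is always reserved for orders opened and closed by the same rack); (7) $\alpha_{ok}=\beta_{ok}$ for all $o\in O_1'$, $k\in\{1,\dots,K\}$; (8) $\gamma_{\tau(o),o,k}=\alpha_{ok}$ for all $o\in O_1'$, $k\in\{1,\dots,K\}$; (9) $\sum_{k=1}^K\beta_{ok}=1$ for all $o\in O'$; (10) $\beta_{o1}\ge 1-\sum_{i\in N^*}\sum_{k=2}^K\gamma_{iok}$ for all $o\in O'\setminus O_1'$; (11) $\beta_{ok}\ge 1-\sum_{i\in N^*}\sum_{n=k+1}^K\gamma_{ion}-\sum_{n=1}^{k-1}\beta_{on}$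 for all $o\in O'\setminus O_1'$, $k\in\{2,\dots,K-1\}$; (12) $\alpha_{ok}\le\sum_{i\in N^*}\sum_{n=1}^k\gamma_{ion}$ for all $o\in O'\setminus O_1'$, $k\in\{1,\dots,K\}$; (13) $\alpha_{ok}\le 1-\sum_{n=1}^{k-1}\beta_{on}$ for all $o\in O'\setminus O_1'$, $k\in\{2,\dots,K\}$; (14) $\alpha_{o,k+1}\ge\alpha_{ok}-\beta_{ok}$ for all $o\in O'\setminus O_1'$, $k\in\{1,\dots,K-1\}$; together with the stated integrality and nonnegativity of the variables. Any feasible solution of this formulation for $O'$ constitutes a feasible rack sequence for the orders $O'$ (given by $z_{kr}$, together with the picking details $\gamma_{iok}$). *)

theory Defs
  imports Main
begin

text \<open>
  Type variables: \<open>'p\<close> products, \<open>'o\<close> orders, \<open>'r\<close> racks.  \<open>Ostar\<close> and \<open>Rstar\<close> are the orders and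
  racks allocated to the picker, \<open>q i ord\<close> is the demand of order \<open>ord\<close> for product \<open>i\<close>, and
  \<open>s i r\<close> is the stock of product \<open>i\<close> on rack \<open>r\<close>.
\<close>

definition required_products :: "'o set \<Rightarrow> ('p \<Rightarrow> 'o \<Rightarrow> nat) \<Rightarrow> 'p set" where
  "required_products Ostar q = {i. (\<Sum>ord\<in>Ostar. q i ord) \<ge> 1}"

definition single_unit_orders :: "'o set \<Rightarrow> ('p \<Rightarrow> 'o \<Rightarrow> nat) \<Rightarrow> 'o set" where
  "single_unit_orders Ostar q =
     {ord \<in> Ostar. (\<Sum>i\<in>required_products Ostar q. q i ord) = 1}"

definition required_product :: "'o set \<Rightarrow> ('p \<Rightarrow> 'o \<Rightarrow> nat) \<Rightarrow> 'o \<Rightarrow> 'p" where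
  "required_product Ostar q ord = (THE i. i \<in> required_products Ostar q \<and> q i ord \<ge> 1)"

text \<open>
  Feasibility of the values \<open>z k r\<close>, \<open>\<alpha> ord k\<close>, \<open>\<beta> ord k\<close>, \<open>\<gamma> i ord k\<close> in the formulation for the
  orders \<open>Os\<close>.  The products range over those required by \<open>Ostar\<close>, whatever \<open>Os\<close> is.
  The variables are integers because the constraints involve genuine subtraction; values outside
  the index ranges are unconstrained.
\<close>

definition PRSF1 ::
  "'o set \<Rightarrow> 'r set \<Rightarrow> ('p \<Rightarrow> 'o \<Rightarrow> nat) \<Rightarrow> ('p \<Rightarrow> 'r \<Rightarrow> nat) \<Rightarrow> nat \<Rightarrow> 'o set \<Rightarrow>
   (nat \<Rightarrow> 'r \<Rightarrow> int) \<Rightarrow> ('o \<Rightarrow> nat \<Rightarrow> int) \<Rightarrow> ('o \<Rightarrow> nat \<Rightarrow> int) \<Rightarrow> ('p \<Rightarrow> 'o \<Rightarrow> nat \<Rightarrow> int) \<Rightarrow> bool"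
where
  "PRSF1 Ostar Rstar q s B Os z \<alpha> \<beta> \<gamma> \<longleftrightarrow>
    (let K = card Rstar;
         N = required_products Ostar q;
         Os1 = Os \<inter> single_unit_orders Ostar q;
         \<tau> = required_product Ostar q
     in
      (\<forall>k\<in>{1..K}. \<forall>r\<in>Rstar. z k r \<in> {0, 1}) \<and>
      (\<forall>ord\<in>Os. \<forall>k\<in>{1..K}. \<alpha> ord k \<in> {0, 1}) \<and>
      (\<forall>ord\<in>Os. \<forall>k\<in>{1..K}. \<beta> ord k \<in> {0, 1}) \<and>
      (\<forall>i\<in>N. \<forall>ord\<in>Os. \<forall>k\<in>{1..K}. \<gamma> i ord k \<ge> 0) \<and>
      (\<forall>r\<in>Rstar. (\<Sum>k=1..K. z k r) = 1) \<and>
      (\<forall>k\<in>{1..K}. (\<Sum>r\<in>Rstar. z k r) = 1) \<and>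
      (\<forall>i\<in>N. \<forall>k\<in>{1..K}. (\<Sum>ord\<in>Os. \<gamma> i ord k) \<le> (\<Sum>r\<in>Rstar. int (s i r) * z k r)) \<and>
      (\<forall>i\<in>N. \<forall>ord\<in>Os. (\<Sum>k=1..K. \<gamma> i ord k) = int (q i ord)) \<and>
      (\<forall>i\<in>N. \<forall>ord\<in>Os. \<forall>k\<in>{1..K}. \<gamma> i ord k \<le> int (q i ord) * \<alpha> ord k) \<and>
      \<comment> \<open>one bin is reserved for orders opened and closed by the same rack\<close>
      (\<forall>k\<in>{1..K}. (\<Sum>ord\<in>Os. \<alpha> ord k - \<beta> ord k) \<le> int B - 1) \<and>
      (\<forall>ord\<in>Os1. \<forall>k\<in>{1..K}. \<alpha> ord k = \<beta> ord k) \<and>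
      (\<forall>ord\<in>Os1. \<forall>k\<in>{1..K}. \<gamma> (\<tau> ord) ord k = \<alpha> ord k) \<and>
      (\<forall>ord\<in>Os. (\<Sum>k=1..K. \<beta> ord k) = 1) \<and>
      (\<forall>ord\<in>Os - Os1. \<beta> ord 1 \<ge> 1 - (\<Sum>i\<in>N. \<Sum>k=2..K. \<gamma> i ord k)) \<and>
      (\<forall>ord\<in>Os - Os1. \<forall>k\<in>{2..K-1}.
         \<beta> ord k \<ge> 1 - (\<Sum>i\<in>N. \<Sum>n=k+1..K. \<gamma> i ord n) - (\<Sum>n=1..k-1. \<beta> ord n)) \<and>
      (\<forall>ord\<in>Os - Os1. \<forall>k\<in>{1..K}. \<alpha> ord k \<le> (\<Sum>i\<in>N. \<Sum>n=1..k. \<gamma> i ord n)) \<and>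
      (\<forall>ord\<in>Os - Os1. \<forall>k\<in>{2..K}. \<alpha> ord k \<le> 1 - (\<Sum>n=1..k-1. \<beta> ord n)) \<and>
      (\<forall>ord\<in>Os - Os1. \<forall>k\<in>{1..K-1}. \<alpha> ord (k+1) \<ge> \<alpha> ord k - \<beta> ord k))"

end

theory Submission
  imports Defs
begin

text \<open>
  The picks of the multi-unit orders are kept.  Summed over all positions of the sequence, the stock
  of a product that they leave over is at least the number of single-unit orders for that product,
  so each single-unit order can be given a position whose rack still has a unit for it.  There it is
  opened and closed by the same rack, hence it only uses the reserved bin.
\<close>

text \<open>Give every \<open>a\<close> in \<open>A\<close> a row of \<open>c a\<close> slots. All
  slots together number \<open>sum c A\<close>, so \<open>S\<close> injects into them. The row of
  the slot is the assignment; within one row the slot index is still injective, which bounds the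
  fibre by \<open>c a\<close>.\<close>

lemma ex_capacitated_assignment:
  fixes c :: "'b \<Rightarrow> nat"
  assumes "finite S" "finite A" "card S \<le> sum c A"
  shows "\<exists>f. f ` S \<subseteq> A \<and> (\<forall>a\<in>A. card {x \<in> S. f x = a} \<le> c a)"
proof -
  have "card S \<le> card (SIGMA a:A. {..<c a})"
    using assms by simp
  then obtain g where g: "g ` S \<subseteq> (SIGMA a:A. {..<c a})" "inj_on g S"
    using card_le_inj[of S "SIGMA a:A. {..<c a}"] assms by auto
  have "card {x \<in> S. fst (g x) = a} \<le> c a" for a
  proof -
    have "inj_on (snd \<circ> g) {x \<in> S. fst (g x) = a}"
      using g(2) by (auto simp: inj_on_def prod_eq_iff)
    moreover have "(snd \<circ> g) ` {x \<in> S. fst (g x) = a} \<subseteq> {..<c a}"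
      using g(1) by (auto simp: image_subset_iff)
    ultimately show ?thesis
      using card_inj_on_le[of "snd \<circ> g" _ "{..<c a}"] by simp
  qed
  moreover have "(fst \<circ> g) ` S \<subseteq> A"
    using g(1) by (auto simp: image_subset_iff mem_Times_iff)
  ultimately show ?thesis
    by (intro exI[of _ "fst \<circ> g"]) simp
qed

text \<open>A sum of naturals is 1 only if one summand is 1 and all others vanish, so the definite
  description denotes that product. The \<open>of_bool\<close> form lets sums of demands become
  cardinalities.\<close>

lemma demand_single_unit_order:
  assumes "finite (required_products Ostar q)" "ord \<in> single_unit_orders Ostar q"
  shows "required_product Ostar q ord \<in> required_products Ostar q"
    and "i \<in> required_products Ostar q \<Longrightarrow> q i ord = of_bool (required_product Ostar q ord = i)"
proof -
  let ?N = "required_products Ostar q"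
  have "(\<Sum>i\<in>?N. q i ord) = 1"
    using assms(2) by (simp add: single_unit_orders_def)
  then obtain j where j: "j \<in> ?N" "q j ord = 1" "\<forall>i\<in>?N. i \<noteq> j \<longrightarrow> q i ord = 0"
    using assms(1) by (auto simp: sum_eq_Suc0_iff)
  have "required_product Ostar q ord = j"
    unfolding required_product_def using j by (intro the_equality) force+
  then show "required_product Ostar q ord \<in> ?N"
    and "i \<in> ?N \<Longrightarrow> q i ord = of_bool (required_product Ostar q ord = i)"
    using j by auto
qed

theorem theorem3:
  fixes Ostar :: "'o set" and Rstar :: "'r set"
    and q :: "'p \<Rightarrow> 'o \<Rightarrow> nat" and s :: "'p \<Rightarrow> 'r \<Rightarrow> nat" and B :: nat
    and z :: "nat \<Rightarrow> 'r \<Rightarrow> int" and \<alpha> \<beta> :: "'o \<Rightarrow> nat \<Rightarrow> int"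
    and \<gamma> :: "'p \<Rightarrow> 'o \<Rightarrow> nat \<Rightarrow> int"
  assumes "finite Ostar" and "finite Rstar" and "finite (required_products Ostar q)"
    and sufficient_stock: "\<forall>i\<in>required_products Ostar q. (\<Sum>ord\<in>Ostar. q i ord) \<le> (\<Sum>r\<in>Rstar. s i r)"
    and feasible: "PRSF1 Ostar Rstar q s B (Ostar - single_unit_orders Ostar q) z \<alpha> \<beta> \<gamma>"
  shows "\<exists>\<alpha>' \<beta>' \<gamma>'.
    PRSF1 Ostar Rstar q s B Ostar z \<alpha>' \<beta>' \<gamma>' \<and>
    (\<forall>ord\<in>Ostar - single_unit_orders Ostar q. \<forall>k\<in>{1..card Rstar}.
       \<alpha>' ord k = \<alpha> ord k \<and> \<beta>' ord k = \<beta> ord k \<and>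
       (\<forall>i\<in>required_products Ostar q. \<gamma>' i ord k = \<gamma> i ord k))"
proof -
  define K N S \<tau> where "K = card Rstar" and "N = required_products Ostar q"
    and "S = single_unit_orders Ostar q" and "\<tau> = required_product Ostar q"
  note folds = K_def[symmetric] N_def[symmetric] S_def[symmetric] \<tau>_def[symmetric]
  have S: "S \<subseteq> Ostar" "finite S"
    using assms(1) by (auto simp: S_def single_unit_orders_def)
  have \<tau>: "\<tau> ord \<in> N" and q_single: "i \<in> N \<Longrightarrow> q i ord = of_bool (\<tau> ord = i)"
    if "ord \<in> S" for ord i
    using demand_single_unit_order[of Ostar q ord] assms(3) that by (auto simp: N_def S_def \<tau>_def)
  \<comment> \<open>These evaluate the set of single-unit orders in the two instances of the
    formulation: it is empty in the given one and \<open>S\<close> in the one to be built. The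
    multi-unit constraints thus range over \<open>Ostar - S\<close> in both.\<close>
  have diff_Int: "(Ostar - S) \<inter> S = {}" "Ostar \<inter> S = S"
    using S by auto
  note F = feasible[unfolded PRSF1_def Let_def folds diff_Int Diff_empty]
  have rack_once: "\<forall>r\<in>Rstar. (\<Sum>k=1..K. z k r) = 1"
    and stock: "\<forall>i\<in>N. \<forall>k\<in>{1..K}. (\<Sum>ord\<in>Ostar - S. \<gamma> i ord k) \<le> (\<Sum>r\<in>Rstar. int (s i r) * z k r)"
    and demand: "\<forall>i\<in>N. \<forall>ord\<in>Ostar - S. (\<Sum>k=1..K. \<gamma> i ord k) = int (q i ord)"
    and closed: "\<forall>ord\<in>Ostar - S. (\<Sum>k=1..K. \<beta> ord k) = 1"
    by (insert F, (elim conjE, assumption)+)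
  have split: "(\<Sum>ord\<in>Ostar. h ord) = (\<Sum>ord\<in>Ostar - S. h ord) + (\<Sum>ord\<in>S. h ord)" for h :: "'o \<Rightarrow> int"
    using S assms(1) by (simp add: sum.subset_diff)

  \<comment> \<open>The units of product \<open>i\<close> that the multi-unit orders leave on the
    \<open>k\<close>-th rack presented.\<close>
  define c where "c i k = (\<Sum>r\<in>Rstar. int (s i r) * z k r) - (\<Sum>ord\<in>Ostar - S. \<gamma> i ord k)" for i k
  have c_nonneg: "c i k \<ge> 0" if "i \<in> N" "k \<in> {1..K}" for i k
    using stock that by (simp add: c_def)
  \<comment> \<open>Orders for different products do not compete for stock, so each product can be
    treated separately, with the leftovers as capacities.\<close>
  have "\<forall>i\<in>N. \<exists>f. f ` {ord \<in> S. \<tau> ord = i} \<subseteq> {1..K} \<and>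
      (\<forall>k\<in>{1..K}. card {ord \<in> {ord \<in> S. \<tau> ord = i}. f ord = k} \<le> nat (c i k))"
  proof (intro ballI ex_capacitated_assignment)
    fix i
    assume i: "i \<in> N"
    \<comment> \<open>Each rack is presented exactly once, so the supply over all positions is the
      total stock, whatever the sequence.\<close>
    have "(\<Sum>k=1..K. \<Sum>r\<in>Rstar. int (s i r) * z k r) = (\<Sum>r\<in>Rstar. int (s i r) * (\<Sum>k=1..K. z k r))"
      by (subst sum.swap) (simp add: sum_distrib_left)
    also have "\<dots> = (\<Sum>r\<in>Rstar. int (s i r))"
      using rack_once by simp
    finally have supplied: "(\<Sum>k=1..K. \<Sum>r\<in>Rstar. int (s i r) * z k r) = (\<Sum>r\<in>Rstar. int (s i r))" .
    have picked: "(\<Sum>k=1..K. \<Sum>ord\<in>Ostar - S. \<gamma> i ord k) = (\<Sum>ord\<in>Ostar - S. int (q i ord))"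
      using demand i by (subst sum.swap) simp
    have "(\<Sum>ord\<in>S. int (q i ord)) = int (card {ord \<in> S. \<tau> ord = i})"
      using S(2) i by (simp add: q_single Int_def)
    moreover have "(\<Sum>ord\<in>Ostar. int (q i ord)) \<le> (\<Sum>r\<in>Rstar. int (s i r))"
      using sufficient_stock i unfolding N_def by (metis of_nat_mono of_nat_sum)
    ultimately have "int (card {ord \<in> S. \<tau> ord = i}) \<le> (\<Sum>k=1..K. c i k)"
      using supplied picked split[of "\<lambda>ord. int (q i ord)"] by (simp add: c_def sum_subtractf)
    \<comment> \<open>The leftovers are nonnegative by the stock constraint, so \<open>nat\<close>
      truncates nothing.\<close>
    also have "\<dots> = int (\<Sum>k=1..K. nat (c i k))"
      using c_nonneg i by simp
    finally show "card {ord \<in> S. \<tau> ord = i} \<le> (\<Sum>k=1..K. nat (c i k))"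
      by linarith
  qed (use S in auto)
  from bchoice[OF this] obtain f where
    "\<forall>i\<in>N. f i ` {ord \<in> S. \<tau> ord = i} \<subseteq> {1..K} \<and>
      (\<forall>k\<in>{1..K}. card {ord \<in> {ord \<in> S. \<tau> ord = i}. f i ord = k} \<le> nat (c i k))" ..
  then have f: "\<And>i. i \<in> N \<Longrightarrow> f i ` {ord \<in> S. \<tau> ord = i} \<subseteq> {1..K}"
    "\<And>i k. i \<in> N \<Longrightarrow> k \<in> {1..K} \<Longrightarrow> card {ord \<in> {ord \<in> S. \<tau> ord = i}. f i ord = k} \<le> nat (c i k)"
    by simp_all
  define p where "p ord = f (\<tau> ord) ord" for ord
  \<comment> \<open>This makes a sum over positions count the indicator of \<open>p ord = k\<close>
    exactly once, as demand and closing require.\<close>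
  have p: "p ord \<in> {1..K}" if "ord \<in> S" for ord
    using f(1)[OF \<tau>[OF that]] that by (auto simp: p_def)

  define \<alpha>' where "\<alpha>' ord k = (if ord \<in> S then of_bool (p ord = k) else \<alpha> ord k)" for ord k
  define \<beta>' where "\<beta>' ord k = (if ord \<in> S then of_bool (p ord = k) else \<beta> ord k)" for ord k
  define \<gamma>' where "\<gamma>' i ord k = (if ord \<in> S then of_bool (\<tau> ord = i \<and> p ord = k) else \<gamma> i ord k)"
    for i ord k
  have new_stock: "\<forall>i\<in>N. \<forall>k\<in>{1..K}. (\<Sum>ord\<in>Ostar. \<gamma>' i ord k) \<le> (\<Sum>r\<in>Rstar. int (s i r) * z k r)"
  proof (intro ballI)
    fix i k
    assume ik: "i \<in> N" "k \<in> {1..K}"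
    have "(\<Sum>ord\<in>S. \<gamma>' i ord k) = int (card {ord \<in> S. \<tau> ord = i \<and> p ord = k})"
      using S(2) by (simp add: \<gamma>'_def Int_def)
    also have "{ord \<in> S. \<tau> ord = i \<and> p ord = k} = {ord \<in> {ord \<in> S. \<tau> ord = i}. f i ord = k}"
      by (auto simp: p_def)
    finally have "(\<Sum>ord\<in>S. \<gamma>' i ord k) \<le> c i k"
      using f(2)[OF ik] c_nonneg[OF ik] by linarith
    then show "(\<Sum>ord\<in>Ostar. \<gamma>' i ord k) \<le> (\<Sum>r\<in>Rstar. int (s i r) * z k r)"
      by (simp add: split c_def \<gamma>'_def)
  qed
  \<comment> \<open>A single-unit order opens and closes at the same position, so its terms cancel
    and the bound \<open>B - 1\<close> is inherited.\<close>
  have new_bins: "(\<Sum>ord\<in>Ostar. \<alpha>' ord k - \<beta>' ord k) = (\<Sum>ord\<in>Ostar - S. \<alpha> ord k - \<beta> ord k)" for k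
    by (simp add: split \<alpha>'_def \<beta>'_def)
  have new_demand: "\<forall>i\<in>N. \<forall>ord\<in>Ostar. (\<Sum>k=1..K. \<gamma>' i ord k) = int (q i ord)"
  proof (intro ballI)
    fix i ord
    assume "i \<in> N" "ord \<in> Ostar"
    then show "(\<Sum>k=1..K. \<gamma>' i ord k) = int (q i ord)"
      using demand p[of ord] by (cases "ord \<in> S") (auto simp: \<gamma>'_def q_single of_bool_conj)
  qed
  have new_closed: "\<forall>ord\<in>Ostar. (\<Sum>k=1..K. \<beta>' ord k) = 1"
  proof
    fix ord
    assume "ord \<in> Ostar"
    then show "(\<Sum>k=1..K. \<beta>' ord k) = 1"
      using closed p[of ord] by (cases "ord \<in> S") (auto simp: \<beta>'_def)
  qed
  have old: "\<alpha>' ord = \<alpha> ord" "\<beta>' ord = \<beta> ord" "\<gamma>' i ord = \<gamma> i ord" if "ord \<in> Ostar - S" for i ord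
    using that by (auto simp: \<alpha>'_def \<beta>'_def \<gamma>'_def)
  have single: "\<alpha>' ord k = of_bool (p ord = k)" "\<beta>' ord k = of_bool (p ord = k)"
    "\<gamma>' i ord k = of_bool (\<tau> ord = i \<and> p ord = k)" if "ord \<in> S" for i ord k
    using that by (auto simp: \<alpha>'_def \<beta>'_def \<gamma>'_def)
  have ball_split: "(\<forall>ord\<in>Ostar. P ord) \<longleftrightarrow> (\<forall>ord\<in>Ostar - S. P ord) \<and> (\<forall>ord\<in>S. P ord)" for P
    using S(1) by blast
  \<comment> \<open>Apart from the three constraints proved separately, each one follows from its
    given counterpart on \<open>Ostar - S\<close> and from evaluating indicators on
    \<open>S\<close>. \<open>ball_cong\<close> supplies the membership premises of
    \<open>old\<close> and \<open>single\<close>; removing \<open>Diff_iff\<close> keeps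
    \<open>Ostar - S\<close> in the form that \<open>old\<close> expects.\<close>
  have "PRSF1 Ostar Rstar q s B Ostar z \<alpha>' \<beta>' \<gamma>'"
    unfolding PRSF1_def Let_def folds diff_Int
    by (intro conjI; (fact new_stock new_demand new_closed
        | (insert F, elim conjE, simp add: new_bins ball_split old single q_single cong: ball_cong del: Diff_iff)))
  then show ?thesis
    using old by (intro exI[of _ \<alpha>'] exI[of _ \<beta>'] exI[of _ \<gamma>']) (simp add: folds)
qed

end
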